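(* Let $Y\subset\mathbb{R}^m$ and $\mathcal{W}\subset\mathbb{R}^q$ be nonempty, convex and compact, let $A,B$ be matrices and $b$ a vector of compatible sizes, and consider $$\mathcal{Q}(x)=\min\{f(y,x): y\in Y,\ Ay+Bx=b\},$$ where $f$ has the saddle point representation $$f(y,x)=x^\top a_1+y^\top a_2+\max_{w\in\mathcal{W}}\big[y^\top A_0w+x^\top B_0w-\phi_0(w)\big],$$ with $a_1\in\mathbb{R}^n$, $a_2\in\mathbb{R}^m$, $A_0\in\mathbb{R}^{m\times q}$, $B_0\in\mathbb{R}^{n\times q}$ and $\phi_0$ convex, proper and lower semicontinuous. Set $$L_x(y,w)=y^\top(a_2+A_0w)+x^\top B_0w-\phi_0(w),\qquad \theta_x(w)=\min\{L_x(y,w): y\in Y,\ Ay+Bx=b\},$$ $$h_{x,w}(\lambda)=\min_{y\in Y}\ L_x(y,w)+\lambda^\top(Ay+Bx-b).$$ Fix $\bar x\in X$ and assume that there is $y_0\in\mathrm{ri}(Y)$ such that $Ay_0+B\bar x=b$. Let $\bar w$ be an optimal solution of $\max_{w\in\mathcal{W}}\theta_{\bar x}(w)$, let $\hat w\in\mathcal{W}$ be an $\varepsilon$-optimal solution of this problem, i.e. $\theta_{\bar x}(\hat w)\ge\theta_{\bar x}(\bar w)-\varepsilon$, let $\hat\lambda$ be a $\delta$-optimal solution of $\theta_{\bar x}(\hat w)=\max_\lambda h_{\bar x,\hat w}(\lambda)$, i.e. $h_{\bar x,\hat w}(\hat\lambda)\ge\theta_{\bar x}(\hat w)-\delta$,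 and let $\hat y$ be a $\tau$-optimal feasible solution of the problem defining $\theta_{\bar x}(\hat w)$, i.e. $$\hat y\in Y,\quad A\hat y+B\bar x=b,\quad L_{\bar x}(\hat y,\hat w)\le\theta_{\bar x}(\hat w)+\tau .$$ Then the affine function $$\mathcal{C}(x)=x^\top\big(a_1+B_0\hat w+B^\top\hat\lambda\big)+\hat y^\top(a_2+A_0\hat w)-\bar x^\top B^\top\hat\lambda-\phi_0(\hat w)-\tau-\delta$$ is an $(\varepsilon+\tau+\delta)$-inexact cut for $\mathcal{Q}$ at $\bar x$.
   Context: Definition ($\varepsilon$-inexact cut). Let $\mathcal{Q}:X\to\mathbb{R}$ be a convex function with $X\subset\mathbb{R}^n$ convex, $X\subset\mathrm{ri}(\mathrm{dom}(\mathcal{Q}))$, and let $\varepsilon\ge0$. A function $\mathcal{C}:X\to\mathbb{R}$ is an $\varepsilon$-inexact cut for $\mathcal{Q}$ at $\bar x\in X$ if $\mathcal{C}$ is affine, $\mathcal{Q}(x)\ge\mathcal{C}(x)$ for all $x\in X$, and $\mathcal{Q}(\bar x)-\mathcal{C}(\bar x)\le\varepsilon$. $\mathrm{ri}$ denotes relative interior; $\varepsilon,\tau,\delta\ge0$. The function $f$ takes values in $\,]-\infty,+\infty]$ (so $\mathcal{W}$ meets the domain of $\phi_0$). *)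

theory Defs
  imports "HOL-Analysis.Analysis"
begin

definition ereal_dom :: "('a \<Rightarrow> ereal) \<Rightarrow> 'a set" where
  "ereal_dom g = {x. g x < \<infinity>}"

definition ereal_proper :: "('a \<Rightarrow> ereal) \<Rightarrow> bool" where
  "ereal_proper g \<longleftrightarrow> (\<forall>x. g x \<noteq> -\<infinity>) \<and> ereal_dom g \<noteq> {}"

(* Convexity of an extended-real-valued function through its epigraph, which lives in the
   product of the space with the (finite) reals and so avoids sums of opposite infinities. *)
definition ereal_convex :: "('a::real_vector \<Rightarrow> ereal) \<Rightarrow> bool" where
  "ereal_convex g \<longleftrightarrow> convex {(x, r::real). g x \<le> ereal r}"

definition ereal_lsc :: "('a::topological_space \<Rightarrow> ereal) \<Rightarrow> bool" where
  "ereal_lsc g \<longleftrightarrow> (\<forall>x. g x \<le> Liminf (at x) g)"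

definition affine_fun_on :: "'a::euclidean_space set \<Rightarrow> ('a \<Rightarrow> real) \<Rightarrow> bool" where
  "affine_fun_on X C \<longleftrightarrow> (\<exists>a c. \<forall>x\<in>X. C x = a \<bullet> x + c)"

(* The first, parenthesised conjunct holds the requirements on the data Q, X, eps, xbar under which the notion
   of an inexact cut is defined: Q is finite and convex on the convex set X (convex_on includes
   convexity of X), and X lies in the relative interior of the domain of the
   extended-valued function Q. *)
definition inexact_cut ::
  "('a::euclidean_space \<Rightarrow> ereal) \<Rightarrow> 'a set \<Rightarrow> real \<Rightarrow> 'a \<Rightarrow> ('a \<Rightarrow> real) \<Rightarrow> bool" where
  "inexact_cut Q X eps xbar C \<longleftrightarrow>
     ((\<forall>x\<in>X. \<bar>Q x\<bar> \<noteq> \<infinity>) \<and> convex_on X (\<lambda>x. real_of_ereal (Q x)) \<and>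
      X \<subseteq> rel_interior (ereal_dom Q) \<and> 0 \<le> eps \<and> xbar \<in> X) \<and>
     affine_fun_on X C \<and>
     (\<forall>x\<in>X. Q x \<ge> ereal (C x)) \<and>
     Q xbar - ereal (C xbar) \<le> ereal eps"

end

theory Submission
  imports Defs
begin

text \<open>
  Weak duality makes \<open>C\<close> a minorant of \<open>Q\<close>. Replacing the maximum over \<open>W\<close> by the value at \<open>what\<close>
  lowers \<open>f\<close>, and for a \<open>y\<close> that is feasible at \<open>x\<close> the multiplier term of \<open>h xbar what lhat\<close> equals
  \<open>lhat \<bullet> B (xbar - x)\<close>. It therefore turns the bound \<open>L xbar yhat what - \<tau> - \<delta> \<le> h xbar what lhat\<close>
  into an affine lower bound in \<open>x\<close>, which is \<open>C\<close>.

  The gap at \<open>xbar\<close> is controlled by strong duality between \<open>y\<close> and \<open>w\<close>: \<open>C xbar\<close> is within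
  \<open>\<epsilon> + \<tau> + \<delta>\<close> of \<open>xbar \<bullet> a1 + \<theta> xbar wbar\<close>, so it is enough that the latter bounds \<open>Q xbar\<close> from above.
  This is a minimax statement. As \<open>L xbar\<close> is affine in \<open>y\<close>, each \<open>w\<close> with \<open>phi0 w\<close> finite yields
  an affine function of \<open>y\<close>, and concavity in \<open>w\<close> says that these functions and all those obtained
  by lowering their constants form a convex set of pairs (slope, constant). The lemma \<open>affine_family_minimax\<close> then gives a
  single feasible \<open>z\<close> at which all of them are at most \<open>\<theta> xbar wbar\<close>.

  Convexity of \<open>Q\<close> holds because \<open>f\<close> is jointly convex, as a supremum of affine functions, and
  partial minimisation preserves convexity (\<open>convex_on_partial_INF\<close>).
\<close>

section \<open>A minimax theorem for affine functions on a compact convex set\<close>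

text \<open>
  The affine functions that exceed \<open>c\<close> throughout \<open>S\<close> form a convex set \<open>K\<close> of pairs
  (slope, constant), disjoint from \<open>H\<close> by hypothesis. A hyperplane separating \<open>H\<close> from \<open>K\<close> cannot be
  vertical, because every slope occurs in \<open>K\<close> with a large constant. Evaluation of affine functions
  at some point \<open>z\<close> is therefore the separating functional, and \<open>z\<close> lies in \<open>S\<close>: otherwise an
  affine function that is positive on \<open>S\<close> and negative at \<open>z\<close>, added to \<open>c + 1\<close> with a large
  factor, stays in \<open>K\<close> while its value at \<open>z\<close> is unbounded below.
\<close>

lemma affine_family_minimax:
  fixes S :: "'a::euclidean_space set" and H :: "('a \<times> real) set" and c :: real
  assumes S: "convex S" "compact S" "S \<noteq> {}"
    and H: "convex H" "H \<noteq> {}"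
    and below: "\<And>p t. (p, t) \<in> H \<Longrightarrow> \<exists>y\<in>S. y \<bullet> p + t \<le> c"
  shows "\<exists>z\<in>S. \<forall>(p, t)\<in>H. z \<bullet> p + t \<le> c"
proof -
  define K where "K = {(p, t). \<forall>y\<in>S. c < y \<bullet> p + t}"
  have "convex K"
  proof (rule convexI)
    fix g h u v
    assume g: "g \<in> K" and h: "h \<in> K" and uv: "0 \<le> (u::real)" "0 \<le> v" "u + v = 1"
    have "c < y \<bullet> (u *\<^sub>R fst g + v *\<^sub>R fst h) + (u * snd g + v * snd h)" if "y \<in> S" for y
    proof -
      have "- (y \<bullet> fst g + snd g) < - c" "- (y \<bullet> fst h + snd h) < - c"
        using g h that by (auto simp: K_def)
      from convex_bound_lt[OF this uv] show ?thesis
        by (simp add: inner_add_right algebra_simps)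
    qed
    then show "u *\<^sub>R g + v *\<^sub>R h \<in> K"
      by (cases g; cases h) (auto simp: K_def)
  qed
  have K_const: "(0, c + 1) \<in> K"
    by (auto simp: K_def)
  have "H \<inter> K = {}"
    using below by (force simp: K_def)
  with H \<open>convex K\<close> K_const obtain n \<alpha> where "n \<noteq> 0"
    and nH: "\<And>g. g \<in> H \<Longrightarrow> n \<bullet> g \<le> \<alpha>" and nK: "\<And>g. g \<in> K \<Longrightarrow> \<alpha> \<le> n \<bullet> g"
    using separating_hyperplane_sets[of H K] by blast
  obtain z0 s where n: "n = (z0, s)"
    by (cases n)
  have slope_K: "\<exists>t. (p, t) \<in> K" for p
  proof -
    obtain y where "\<forall>x\<in>S. y \<bullet> p \<le> x \<bullet> p"
      using continuous_attains_inf[OF S(2,3) continuous_on_inner[OF continuous_on_id continuous_on_const]]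
      by blast
    then have "(p, c + 1 - y \<bullet> p) \<in> K"
      by (force simp: K_def)
    then show ?thesis ..
  qed
  have K_up: "(p, t + r) \<in> K" if "(p, t) \<in> K" "0 \<le> r" for p t r
    using that by (force simp: K_def)
  have "0 \<le> s"
  proof (rule ccontr)
    assume "\<not> 0 \<le> s"
    define r where "r = (\<bar>\<alpha> - s * (c + 1)\<bar> + 1) / - s"
    have r: "0 \<le> r" "s * r = - (\<bar>\<alpha> - s * (c + 1)\<bar> + 1)"
      using \<open>\<not> 0 \<le> s\<close> by (auto simp: r_def field_simps)
    have "\<alpha> \<le> s * (c + 1 + r)"
      using nK[OF K_up[OF K_const r(1)]] by (simp add: n)
    then show False
      using r(2) by (simp add: distrib_left)
  qed
  moreover have "s \<noteq> 0"
  proof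
    assume "s = 0"
    then have "z0 \<noteq> 0"
      using \<open>n \<noteq> 0\<close> n by (simp add: zero_prod_def)
    have lower: "\<alpha> \<le> z0 \<bullet> p" for p
      using slope_K[of p] nK n \<open>s = 0\<close> by fastforce
    have "\<alpha> \<le> - (\<bar>\<alpha>\<bar> + 1)"
      using lower[of "(- (\<bar>\<alpha>\<bar> + 1) / (z0 \<bullet> z0)) *\<^sub>R z0"] \<open>z0 \<noteq> 0\<close> by simp
    then show False
      by simp
  qed
  ultimately have s: "0 < s"
    by simp
  define z where "z = z0 /\<^sub>R s"
  have nz: "n \<bullet> (p, t) = s * (z \<bullet> p + t)" for p t
    using s by (simp add: n z_def field_simps)
  have zH: "z \<bullet> p + t \<le> \<alpha> / s" if "(p, t) \<in> H" for p t
    using nH[OF that] s unfolding nz by (simp add: field_simps)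
  have zK: "\<alpha> / s \<le> z \<bullet> p + t" if "(p, t) \<in> K" for p t
    using nK[OF that] s unfolding nz by (simp add: field_simps)
  have "\<alpha> / s \<le> c"
  proof (rule field_le_epsilon)
    fix e :: real
    assume "0 < e"
    then have "(0, c + e) \<in> K"
      by (auto simp: K_def)
    from zK[OF this] show "\<alpha> / s \<le> c + e"
      by simp
  qed
  have "z \<in> S"
  proof (rule ccontr)
    assume "z \<notin> S"
    then obtain a \<beta> where a: "a \<bullet> z < \<beta>" "\<forall>x\<in>S. \<beta> < a \<bullet> x"
      using separating_hyperplane_closed_point[of S z] S compact_imp_closed by blast
    define r where "r = (\<bar>c + 1 - \<alpha> / s\<bar> + 1) / (\<beta> - a \<bullet> z)"
    have r: "0 \<le> r" "r * (\<beta> - a \<bullet> z) = \<bar>c + 1 - \<alpha> / s\<bar> + 1"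
      using a(1) by (auto simp: r_def)
    have "c < y \<bullet> (r *\<^sub>R a) + (c + 1 - r * \<beta>)" if "y \<in> S" for y
    proof -
      have "r * \<beta> \<le> r * (a \<bullet> y)"
        using a(2) that r(1) by (intro mult_left_mono) auto
      then show ?thesis
        by (simp add: inner_commute)
    qed
    then have "(r *\<^sub>R a, c + 1 - r * \<beta>) \<in> K"
      by (simp add: K_def)
    from zK[OF this] show False
      using r(2) by (simp add: inner_commute algebra_simps)
  qed
  then show ?thesis
    using zH \<open>\<alpha> / s \<le> c\<close> by (intro bexI[of _ z]) force+
qed

section \<open>Convexity of extended-real-valued functions\<close>

lemma ereal_convexD:
  assumes "ereal_convex g" "g x \<le> ereal r" "g y \<le> ereal s"
    and "0 \<le> u" "0 \<le> v" "u + v = 1"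
  shows "g (u *\<^sub>R x + v *\<^sub>R y) \<le> ereal (u * r + v * s)"
  using convexD[of "{(x, r::real). g x \<le> ereal r}" "(x, r)" "(y, s)" u v] assms
  by (simp add: ereal_convex_def)

text \<open>
  The infimum defining \<open>q\<close> need not be attained, so convexity is checked with minimisers up to an
  arbitrary \<open>e\<close>.
\<close>

lemma convex_on_partial_INF:
  fixes F :: "'a::real_vector \<times> 'b::real_vector \<Rightarrow> ereal" and q :: "'b \<Rightarrow> ereal"
  assumes F: "ereal_convex F" and D: "convex D" and X: "convex X"
    and q: "\<And>x. q x = (INF y\<in>{y. (y, x) \<in> D}. F (y, x))"
    and finite: "\<And>x. x \<in> X \<Longrightarrow> \<bar>q x\<bar> \<noteq> \<infinity>"
  shows "convex_on X (\<lambda>x. real_of_ereal (q x))"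
proof -
  have approx: "\<exists>y. (y, x) \<in> D \<and> F (y, x) \<le> ereal (real_of_ereal (q x) + e)"
    if "x \<in> X" "0 < e" for x e
  proof -
    have "q x < ereal (real_of_ereal (q x) + e)"
      using finite[OF that(1)] that(2) by (cases "q x") auto
    then show ?thesis
      unfolding q[of x] INF_less_iff by (auto intro: less_imp_le)
  qed
  have "real_of_ereal (q (u *\<^sub>R x + v *\<^sub>R x'))
          \<le> u * real_of_ereal (q x) + v * real_of_ereal (q x')"
    if x: "x \<in> X" "x' \<in> X" and uv: "0 \<le> u" "0 \<le> v" "u + v = 1" for x x' u v
  proof (rule field_le_epsilon)
    fix e :: real
    assume "0 < e"
    obtain y y' where y: "(y, x) \<in> D" "F (y, x) \<le> ereal (real_of_ereal (q x) + e)"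
      and y': "(y', x') \<in> D" "F (y', x') \<le> ereal (real_of_ereal (q x') + e)"
      using approx[OF x(1) \<open>0 < e\<close>] approx[OF x(2) \<open>0 < e\<close>] by blast
    have "(u *\<^sub>R y + v *\<^sub>R y', u *\<^sub>R x + v *\<^sub>R x') \<in> D"
      using convexD[OF D y(1) y'(1) uv] by simp
    then have "q (u *\<^sub>R x + v *\<^sub>R x') \<le> F (u *\<^sub>R y + v *\<^sub>R y', u *\<^sub>R x + v *\<^sub>R x')"
      unfolding q by (intro INF_lower) simp
    also have "\<dots> \<le> ereal (u * (real_of_ereal (q x) + e) + v * (real_of_ereal (q x') + e))"
      using ereal_convexD[OF F y(2) y'(2) uv] by simp
    also have "u * (real_of_ereal (q x) + e) + v * (real_of_ereal (q x') + e)
        = u * real_of_ereal (q x) + v * real_of_ereal (q x') + (u + v) * e"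
      by (simp add: algebra_simps)
    finally have "q (u *\<^sub>R x + v *\<^sub>R x')
        \<le> ereal (u * real_of_ereal (q x) + v * real_of_ereal (q x') + e)"
      by (simp add: uv(3))
    moreover have "\<bar>q (u *\<^sub>R x + v *\<^sub>R x')\<bar> \<noteq> \<infinity>"
      by (rule finite[OF convexD[OF X x uv]])
    ultimately show "real_of_ereal (q (u *\<^sub>R x + v *\<^sub>R x'))
        \<le> u * real_of_ereal (q x) + v * real_of_ereal (q x') + e"
      by (cases "q (u *\<^sub>R x + v *\<^sub>R x')") auto
  qed
  then show ?thesis
    by (simp add: convex_on_def X)
qed

text \<open>
  Points where \<open>g\<close> is infinite contribute \<open>-\<infinity>\<close> to the supremum, so only the finite values of \<open>g\<close>
  constrain it and the comparison reduces to inequalities between reals.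
\<close>

lemma add_SUP_diff_le_iff:
  fixes g :: "'a \<Rightarrow> ereal"
  assumes "\<And>w. g w \<noteq> -\<infinity>"
  shows "ereal k + (SUP w\<in>W. ereal (l w) - g w) \<le> ereal r \<longleftrightarrow>
    (\<forall>w\<in>W. \<forall>p. g w = ereal p \<longrightarrow> k + l w - p \<le> r)"
proof -
  have "ereal k + s \<le> ereal r \<longleftrightarrow> s \<le> ereal (r - k)" for s
    by (cases s) auto
  moreover have "ereal (l w) - g w \<le> ereal (r - k) \<longleftrightarrow> (\<forall>p. g w = ereal p \<longrightarrow> k + l w - p \<le> r)" for w
    using assms[of w] by (cases "g w") auto
  ultimately show ?thesis
    by (simp add: SUP_le_iff)
qed

lemma saddle_function_convex:
  fixes phi :: "'w \<Rightarrow> ereal" and p :: "'w \<Rightarrow> 'a::real_inner" and q :: "'w \<Rightarrow> 'b::real_inner"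
  assumes "\<And>w. phi w \<noteq> -\<infinity>"
  shows "ereal_convex (\<lambda>(y, x). ereal (x \<bullet> a1 + y \<bullet> a2) +
          (SUP w\<in>W. ereal (y \<bullet> p w + x \<bullet> q w) - phi w))"
proof -
  have "convex {(yx, r). \<forall>w\<in>W. \<forall>c. phi w = ereal c \<longrightarrow>
      (snd yx \<bullet> a1 + fst yx \<bullet> a2) + (fst yx \<bullet> p w + snd yx \<bullet> q w) - c \<le> r}"
    (is "convex ?E")
  proof (rule convexI)
    fix g h u v
    assume g: "g \<in> ?E" and h: "h \<in> ?E" and uv: "0 \<le> (u::real)" "0 \<le> v" "u + v = 1"
    obtain y x r y' x' r' where gh: "g = ((y, x), r)" "h = ((y', x'), r')"
      by (metis surj_pair)
    have "((u *\<^sub>R x + v *\<^sub>R x') \<bullet> a1 + (u *\<^sub>R y + v *\<^sub>R y') \<bullet> a2) +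
        ((u *\<^sub>R y + v *\<^sub>R y') \<bullet> p w + (u *\<^sub>R x + v *\<^sub>R x') \<bullet> q w) - c
        \<le> u * r + v * r'" if w: "w \<in> W" "phi w = ereal c" for w c
    proof -
      have "(x \<bullet> a1 + y \<bullet> a2) + (y \<bullet> p w + x \<bullet> q w) \<le> r + c"
        "(x' \<bullet> a1 + y' \<bullet> a2) + (y' \<bullet> p w + x' \<bullet> q w) \<le> r' + c"
        using g h w by (force simp: gh)+
      then have "u * ((x \<bullet> a1 + y \<bullet> a2) + (y \<bullet> p w + x \<bullet> q w))
          + v * ((x' \<bullet> a1 + y' \<bullet> a2) + (y' \<bullet> p w + x' \<bullet> q w))
          \<le> u * (r + c) + v * (r' + c)"
        using uv by - (rule add_mono; rule mult_left_mono; simp)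
      also have "\<dots> = u * r + v * r' + (u + v) * c"
        by (simp add: algebra_simps)
      finally show ?thesis
        using uv(3) by (simp add: inner_add_left algebra_simps)
    qed
    then show "u *\<^sub>R g + v *\<^sub>R h \<in> ?E"
      by (simp add: gh)
  qed
  then show ?thesis
    by (simp add: ereal_convex_def add_SUP_diff_le_iff[of phi, OF assms] case_prod_unfold)
qed

section \<open>Inexact cuts from approximate primal and dual solutions\<close>

text \<open>
  Both halves of the argument compute with the real number \<open>L xbar yhat what\<close>, so \<open>phi0 what\<close> must
  be finite. Since \<open>f\<close> never takes the value \<open>-\<infinity>\<close>, some \<open>w0 \<in> W\<close> has a finite \<open>phi0 w0\<close>, and
  boundedness of \<open>Y\<close> keeps \<open>\<theta> xbar w0\<close> away from \<open>-\<infinity>\<close>. This passes first to the maximum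
  \<open>\<theta> xbar wbar\<close> and then to its approximation \<open>\<theta> xbar what\<close>, which lies below \<open>L xbar yhat what\<close>.
  The same \<open>w0\<close> bounds \<open>f\<close>, and hence \<open>Q\<close>, from below.
\<close>

theorem proposition3p2:
  fixes Y :: "(real ^ 'm) set" and W :: "(real ^ 'q) set" and X :: "(real ^ 'n) set"
    and A :: "real ^ 'm ^ 'p" and B :: "real ^ 'n ^ 'p" and b :: "real ^ 'p"
    and a1 :: "real ^ 'n" and a2 :: "real ^ 'm"
    and A0 :: "real ^ 'q ^ 'm" and B0 :: "real ^ 'q ^ 'n"
    and phi0 :: "real ^ 'q \<Rightarrow> ereal"
    and f :: "real ^ 'm \<Rightarrow> real ^ 'n \<Rightarrow> ereal"
    and Q :: "real ^ 'n \<Rightarrow> ereal"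
    and L :: "real ^ 'n \<Rightarrow> real ^ 'm \<Rightarrow> real ^ 'q \<Rightarrow> ereal"
    and \<theta> :: "real ^ 'n \<Rightarrow> real ^ 'q \<Rightarrow> ereal"
    and h :: "real ^ 'n \<Rightarrow> real ^ 'q \<Rightarrow> real ^ 'p \<Rightarrow> ereal"
    and \<epsilon> \<tau> \<delta> :: real
    and xbar :: "real ^ 'n" and y0 yhat :: "real ^ 'm" and wbar what :: "real ^ 'q"
    and lhat :: "real ^ 'p"
  assumes Y: "Y \<noteq> {}" "convex Y" "compact Y"
    and W: "W \<noteq> {}" "convex W" "compact W"
    and phi0: "ereal_convex phi0" "ereal_proper phi0" "ereal_lsc phi0"
    and f_saddle: "\<And>y x. f y x = ereal (x \<bullet> a1 + y \<bullet> a2) +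
          (SUP w\<in>W. ereal (y \<bullet> (A0 *v w) + x \<bullet> (B0 *v w)) - phi0 w)"
    and f_values: "\<And>y x. f y x \<noteq> -\<infinity>"
    and Q: "\<And>x. Q x = (INF y\<in>{y\<in>Y. A *v y + B *v x = b}. f y x)"
    and L: "\<And>x y w. L x y w = ereal (y \<bullet> (a2 + A0 *v w) + x \<bullet> (B0 *v w)) - phi0 w"
    and \<theta>: "\<And>x w. \<theta> x w = (INF y\<in>{y\<in>Y. A *v y + B *v x = b}. L x y w)"
    and h: "\<And>x w l. h x w l =
          (INF y\<in>Y. L x y w + ereal (l \<bullet> (A *v y + B *v x - b)))"
    and X: "convex X" "X \<subseteq> rel_interior (ereal_dom Q)"
    and tolerances: "\<epsilon> \<ge> 0" "\<tau> \<ge> 0" "\<delta> \<ge> 0"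
    and xbar: "xbar \<in> X"
    and y0: "y0 \<in> rel_interior Y" "A *v y0 + B *v xbar = b"
    and wbar: "wbar \<in> W" "\<And>w. w \<in> W \<Longrightarrow> \<theta> xbar w \<le> \<theta> xbar wbar"
    and what: "what \<in> W" "\<theta> xbar what \<ge> \<theta> xbar wbar - ereal \<epsilon>"
    and lhat: "h xbar what lhat \<ge> \<theta> xbar what - ereal \<delta>"
    and yhat: "yhat \<in> Y" "A *v yhat + B *v xbar = b"
          "L xbar yhat what \<le> \<theta> xbar what + ereal \<tau>"
  shows "inexact_cut Q X (\<epsilon> + \<tau> + \<delta>) xbar
    (\<lambda>x. x \<bullet> (a1 + B0 *v what + transpose B *v lhat) + yhat \<bullet> (a2 + A0 *v what)
         - xbar \<bullet> (transpose B *v lhat) - real_of_ereal (phi0 what) - \<tau> - \<delta>)"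
proof -
  let ?S = "\<lambda>x. {y\<in>Y. A *v y + B *v x = b}"
  have phi_nmi: "phi0 w \<noteq> -\<infinity>" for w
    using phi0(2) by (simp add: ereal_proper_def)
  have f_le: "f y x \<le> ereal r \<longleftrightarrow> (\<forall>w\<in>W. \<forall>p. phi0 w = ereal p \<longrightarrow>
      (x \<bullet> a1 + y \<bullet> a2) + (y \<bullet> (A0 *v w) + x \<bullet> (B0 *v w)) - p \<le> r)" for y x r
    unfolding f_saddle by (rule add_SUP_diff_le_iff[OF phi_nmi])
  have f_ge: "ereal ((x \<bullet> a1 + y \<bullet> a2) + (y \<bullet> (A0 *v w) + x \<bullet> (B0 *v w)) - p) \<le> f y x"
    if "w \<in> W" "phi0 w = ereal p" for x y w p
    using f_le[of y x "real_of_ereal (f y x)"] f_values[of y x] that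
    by (cases "f y x") auto
  have L_real: "L x y w = ereal (y \<bullet> (a2 + A0 *v w) + x \<bullet> (B0 *v w) - p)"
    if "phi0 w = ereal p" for x y w p
    by (simp add: L that)

  have "\<exists>w0\<in>W. \<exists>p0. phi0 w0 = ereal p0"
  proof (rule ccontr)
    assume "\<not> ?thesis"
    then have le: "f 0 0 \<le> ereal r" for r
      by (auto simp: f_le)
    show False
      using le[of "real_of_ereal (f 0 0) - 1"] le[of 0] f_values[of 0 0] by (cases "f 0 0") auto
  qed
  then obtain w0 p0 where w0: "w0 \<in> W" "phi0 w0 = ereal p0"
    by blast
  have Y_lower: "\<exists>m. \<forall>y\<in>Y. m \<le> y \<bullet> a" for a
    using continuous_attains_inf[OF Y(3,1) continuous_on_inner[OF continuous_on_id continuous_on_const]]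
    by blast

  have Q_finite: "\<bar>Q x\<bar> \<noteq> \<infinity>" if "x \<in> X" for x
  proof -
    have "Q x < \<infinity>"
      using that X(2) rel_interior_subset[of "ereal_dom Q"] by (auto simp: ereal_dom_def)
    moreover obtain m where m: "\<forall>y\<in>Y. m \<le> y \<bullet> (a2 + A0 *v w0)"
      using Y_lower by blast
    have "ereal (m + x \<bullet> a1 + x \<bullet> (B0 *v w0) - p0) \<le> Q x"
      unfolding Q
    proof (rule INF_greatest)
      fix y
      assume "y \<in> ?S x"
      then have "ereal (m + x \<bullet> a1 + x \<bullet> (B0 *v w0) - p0)
          \<le> ereal ((x \<bullet> a1 + y \<bullet> a2) + (y \<bullet> (A0 *v w0) + x \<bullet> (B0 *v w0)) - p0)"
        using m by (force simp: inner_add_right)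
      also have "\<dots> \<le> f y x"
        by (rule f_ge[OF w0])
      finally show "ereal (m + x \<bullet> a1 + x \<bullet> (B0 *v w0) - p0) \<le> f y x" .
    qed
    ultimately show ?thesis
      by (cases "Q x") auto
  qed

  have Q_convex: "convex_on X (\<lambda>x. real_of_ereal (Q x))"
  proof (rule convex_on_partial_INF[OF _ _ X(1) _ Q_finite])
    show "ereal_convex (\<lambda>(y, x). f y x)"
      unfolding f_saddle by (rule saddle_function_convex[OF phi_nmi])
    show "convex {(y, x). y \<in> Y \<and> A *v y + B *v x = b}"
    proof (rule convexI)
      fix g h u v
      assume g: "g \<in> {(y, x). y \<in> Y \<and> A *v y + B *v x = b}"
        and h: "h \<in> {(y, x). y \<in> Y \<and> A *v y + B *v x = b}"
        and uv: "0 \<le> (u::real)" "0 \<le> v" "u + v = 1"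
      obtain y x y' x' where gh: "g = (y, x)" "h = (y', x')"
        by (metis surj_pair)
      have "A *v (u *\<^sub>R y + v *\<^sub>R y') + B *v (u *\<^sub>R x + v *\<^sub>R x')
          = u *\<^sub>R (A *v y + B *v x) + v *\<^sub>R (A *v y' + B *v x')"
        by (simp add: matrix_vector_right_distrib matrix_vector_mult_scaleR algebra_simps)
      also have "\<dots> = b"
        using g h uv(3) by (simp add: gh flip: scaleR_add_left)
      finally show "u *\<^sub>R g + v *\<^sub>R h \<in> {(y, x). y \<in> Y \<and> A *v y + B *v x = b}"
        using g h uv convexD[OF Y(2)] by (simp add: gh)
    qed
    show "Q x = (INF y\<in>{y. (y, x) \<in> {(y, x). y \<in> Y \<and> A *v y + B *v x = b}}. case (y, x) of (y, x) \<Rightarrow> f y x)"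
      for x
      by (simp add: Q)
  qed

  have yhat_S: "yhat \<in> ?S xbar"
    using yhat by simp
  have "\<theta> xbar wbar \<noteq> \<infinity>"
  proof -
    have "\<theta> xbar wbar \<le> L xbar yhat wbar"
      unfolding \<theta> by (rule INF_lower[OF yhat_S])
    also have "\<dots> < \<infinity>"
      using phi_nmi[of wbar] by (cases "phi0 wbar") (auto simp: L)
    finally show ?thesis
      by simp
  qed
  moreover have "\<theta> xbar wbar \<noteq> -\<infinity>"
  proof -
    obtain m where m: "\<forall>y\<in>Y. m \<le> y \<bullet> (a2 + A0 *v w0)"
      using Y_lower by blast
    then have "ereal (m + xbar \<bullet> (B0 *v w0) - p0) \<le> \<theta> xbar w0"
      unfolding \<theta> by (intro INF_greatest) (auto simp: L_real[OF w0(2)])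
    also have "\<dots> \<le> \<theta> xbar wbar"
      by (rule wbar(2)[OF w0(1)])
    finally show ?thesis
      by auto
  qed
  ultimately obtain v where v: "\<theta> xbar wbar = ereal v"
    by (cases "\<theta> xbar wbar") auto
  have \<theta>hat_lower: "ereal (v - \<epsilon>) \<le> \<theta> xbar what"
    using what(2) by (simp add: v)
  have \<theta>hat_le: "\<theta> xbar what \<le> L xbar yhat what"
    unfolding \<theta> by (rule INF_lower[OF yhat_S])
  obtain p where p: "phi0 what = ereal p"
    using order_trans[OF \<theta>hat_lower \<theta>hat_le] phi_nmi[of what]
    by (cases "phi0 what") (auto simp: L)
  define lval where "lval = yhat \<bullet> (a2 + A0 *v what) + xbar \<bullet> (B0 *v what) - p"
  have lval: "L xbar yhat what = ereal lval"
    by (simp add: L_real[OF p] lval_def)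
  have lval_ge: "v - \<epsilon> \<le> lval"
    using order_trans[OF \<theta>hat_lower \<theta>hat_le] by (simp add: lval)

  define C where "C x = x \<bullet> (a1 + B0 *v what + transpose B *v lhat) + yhat \<bullet> (a2 + A0 *v what)
         - xbar \<bullet> (transpose B *v lhat) - real_of_ereal (phi0 what) - \<tau> - \<delta>" for x
  have C_eq: "C x = x \<bullet> a1 + (x - xbar) \<bullet> (B0 *v what) + lhat \<bullet> (B *v x - B *v xbar)
      + lval - \<tau> - \<delta>" for x
  proof -
    have transpose: "u \<bullet> (lhat v* B) = lhat \<bullet> (B *v u)" for u
      by (metis dot_lmul_matrix inner_commute)
    show ?thesis
      by (simp add: C_def lval_def p inner_add_right inner_diff_left inner_diff_right transpose)
  qed

  have C_affine: "affine_fun_on X C"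
    unfolding affine_fun_on_def
  proof (intro exI ballI)
    show "C x = (a1 + B0 *v what + transpose B *v lhat) \<bullet> x
        + (yhat \<bullet> (a2 + A0 *v what) - xbar \<bullet> (transpose B *v lhat) - p - \<tau> - \<delta>)" for x
      by (simp add: C_def p inner_commute)
  qed

  have C_le_Q: "ereal (C x) \<le> Q x" for x
    unfolding Q
  proof (rule INF_greatest)
    fix y
    assume "y \<in> ?S x"
    then have y: "y \<in> Y" "A *v y = b - B *v x"
      by (auto simp: algebra_simps)
    have "ereal (lval - \<tau> - \<delta>) \<le> \<theta> xbar what - ereal \<delta>"
      using yhat(3) by (cases "\<theta> xbar what") (auto simp: lval)
    also have "\<dots> \<le> h xbar what lhat"
      by (rule lhat)
    also have "\<dots> \<le> L xbar y what + ereal (lhat \<bullet> (A *v y + B *v xbar - b))"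
      unfolding h by (rule INF_lower[OF y(1)])
    finally have "C x \<le> (x \<bullet> a1 + y \<bullet> a2) + (y \<bullet> (A0 *v what) + x \<bullet> (B0 *v what)) - p"
      unfolding L_real[OF p] C_eq y(2)
      by (simp add: inner_add_right inner_diff_left inner_diff_right)
    then have "ereal (C x)
        \<le> ereal ((x \<bullet> a1 + y \<bullet> a2) + (y \<bullet> (A0 *v what) + x \<bullet> (B0 *v what)) - p)"
      by simp
    also have "\<dots> \<le> f y x"
      by (rule f_ge[OF what(1) p])
    finally show "ereal (C x) \<le> f y x" .
  qed

  have Q_le: "Q xbar \<le> ereal (xbar \<bullet> a1 + v)"
  proof -
    (* Taking t below, rather than equal to, the constant term of L is what makes H convex:
       H is a hypograph of a concave function of w, mapped by an affine map. *)
    define H where "H = {(g, t). \<exists>w\<in>W. g = a2 + A0 *v w \<and> phi0 w \<le> ereal (xbar \<bullet> (B0 *v w) - t)}"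
    have S: "convex (?S xbar)" "compact (?S xbar)"
    proof -
      have lin: "linear ((*v) A)"
        by simp
      have S_eq: "?S xbar = Y \<inter> (*v) A -` {b - B *v xbar}"
        by (auto simp: algebra_simps)
      show "convex (?S xbar)"
        unfolding S_eq by (intro convex_Int Y convex_linear_vimage lin) simp
      have "closed ((*v) A -` {b - B *v xbar})"
        by (intro closed_vimage) (auto intro: linear_continuous_on simp: lin linear_linear)
      then show "compact (?S xbar)"
        unfolding S_eq by (intro compact_Int_closed Y)
    qed
    have "convex H"
    proof (rule convexI)
      fix g h r s
      assume g: "g \<in> H" and h: "h \<in> H" and rs: "0 \<le> (r::real)" "0 \<le> s" "r + s = 1"
      obtain w t where w: "w \<in> W" "g = (a2 + A0 *v w, t)" "phi0 w \<le> ereal (xbar \<bullet> (B0 *v w) - t)"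
        using g by (auto simp: H_def)
      obtain w' t' where w': "w' \<in> W" "h = (a2 + A0 *v w', t')"
        "phi0 w' \<le> ereal (xbar \<bullet> (B0 *v w') - t')"
        using h by (auto simp: H_def)
      have "r *\<^sub>R (a2 + A0 *v w) + s *\<^sub>R (a2 + A0 *v w')
          = (r + s) *\<^sub>R a2 + A0 *v (r *\<^sub>R w + s *\<^sub>R w')"
        by (simp add: matrix_vector_right_distrib matrix_vector_mult_scaleR algebra_simps)
      then have "r *\<^sub>R (a2 + A0 *v w) + s *\<^sub>R (a2 + A0 *v w')
          = a2 + A0 *v (r *\<^sub>R w + s *\<^sub>R w')"
        by (simp add: rs(3))
      moreover have "phi0 (r *\<^sub>R w + s *\<^sub>R w')
          \<le> ereal (xbar \<bullet> (B0 *v (r *\<^sub>R w + s *\<^sub>R w')) - (r * t + s * t'))"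
        using ereal_convexD[OF phi0(1) w(3) w'(3) rs]
        by (simp add: matrix_vector_right_distrib matrix_vector_mult_scaleR inner_add_right
            algebra_simps)
      moreover have "r *\<^sub>R w + s *\<^sub>R w' \<in> W"
        by (rule convexD[OF W(2) w(1) w'(1) rs])
      ultimately show "r *\<^sub>R g + s *\<^sub>R h \<in> H"
        by (auto simp: H_def w(2) w'(2))
    qed
    have in_H: "(a2 + A0 *v w, xbar \<bullet> (B0 *v w) - r) \<in> H" if "w \<in> W" "phi0 w = ereal r" for w r
      using that by (auto simp: H_def)
    have below: "\<exists>y\<in>?S xbar. y \<bullet> g + t \<le> v" if gt: "(g, t) \<in> H" for g t
    proof -
      obtain w where w: "w \<in> W" "g = a2 + A0 *v w" "phi0 w \<le> ereal (xbar \<bullet> (B0 *v w) - t)"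
        using gt by (auto simp: H_def)
      obtain r where r: "phi0 w = ereal r" "r \<le> xbar \<bullet> (B0 *v w) - t"
        using w(3) phi_nmi[of w] by (cases "phi0 w") auto
      (* Compactness attains the infimum defining the dual function, which is at most v. *)
      obtain y where y: "y \<in> ?S xbar" "\<forall>y'\<in>?S xbar. y \<bullet> g \<le> y' \<bullet> g"
        using continuous_attains_inf[OF S(2) _ continuous_on_inner[OF continuous_on_id continuous_on_const]]
          yhat_S by blast
      have "ereal (y \<bullet> g + xbar \<bullet> (B0 *v w) - r) \<le> \<theta> xbar w"
        unfolding \<theta> L_real[OF r(1)] w(2)[symmetric]
        using y(2) by (intro INF_greatest) simp
      also have "\<dots> \<le> ereal v"
        using wbar(2)[OF w(1)] by (simp add: v)
      finally show ?thesis
        using r(2) y(1) by (intro bexI[of _ y]) simp_all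
    qed
    obtain z where z: "z \<in> ?S xbar" "\<forall>(g, t)\<in>H. z \<bullet> g + t \<le> v"
      using affine_family_minimax[OF S _ \<open>convex H\<close> _ below] yhat_S in_H[OF w0] by blast
    have "Q xbar \<le> f z xbar"
      unfolding Q by (rule INF_lower[OF z(1)])
    also have "\<dots> \<le> ereal (xbar \<bullet> a1 + v)"
      unfolding f_le
    proof (intro ballI allI impI)
      fix w r
      assume "w \<in> W" "phi0 w = ereal r"
      from bspec[OF z(2) in_H[OF this]]
      show "(xbar \<bullet> a1 + z \<bullet> a2) + (z \<bullet> (A0 *v w) + xbar \<bullet> (B0 *v w)) - r \<le> xbar \<bullet> a1 + v"
        by (simp add: inner_add_right)
    qed
    finally show ?thesis .
  qed

  have "Q xbar - ereal (C xbar) \<le> ereal (xbar \<bullet> a1 + v) - ereal (C xbar)"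
    using Q_le by (intro ereal_minus_mono) auto
  also have "\<dots> \<le> ereal (\<epsilon> + \<tau> + \<delta>)"
    using lval_ge by (simp add: C_eq)
  finally have "Q xbar - ereal (C xbar) \<le> ereal (\<epsilon> + \<tau> + \<delta>)" .
  then have "inexact_cut Q X (\<epsilon> + \<tau> + \<delta>) xbar C"
    using Q_finite Q_convex X(2) tolerances xbar C_affine C_le_Q by (simp add: inexact_cut_def)
  then show ?thesis
    by (simp add: C_def[abs_def])
qed

end
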